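(* Let $\mathbb{Q}$ be a probability measure on $(\Omega,\mathcal{A})$ such that $\xi$ is mass-stationary with respect to $\mathbb{Q}$. Assume that $\mathbb{Q}(0<\xi(\mathbb{G})<\infty)=1$ and that $\vartheta:=\mathbb{E}_{\mathbb{Q}}[\xi(\mathbb{G})^{-1}]<\infty$. Let $T\colon\Omega\to\mathbb{G}$ be an anchoring map and define the probability measure $$\mathbb{Q}_T:=\vartheta^{-1}\,\mathbb{E}_{\mathbb{Q}}\,\xi(\mathbb{G})^{-1}\mathbf 1\{\theta_T\in\cdot\},$$ where $\theta_T$ denotes the map $\omega\mapsto\theta_{T(\omega)}\omega$. Then for all measurable $g\colon\Omega\to[0,\infty]$, $$\mathbb{E}_{\mathbb{Q}}\,g=\vartheta\,\mathbb{E}_{\mathbb{Q}_T}\int g\circ\theta_s\,\xi(ds).$$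
   Context: $\mathbb{G}$ is a second countable locally compact Hausdorff Abelian group (additive, neutral element $0$) with Borel $\sigma$-field $\mathcal{G}$ and non-trivial Haar measure $\lambda$. $(\Omega,\mathcal{A})$ is a measurable space with a measurable flow $\{\theta_s:s\in\mathbb{G}\}$: maps $\theta_s\colon\Omega\to\Omega$ such that $(\omega,s)\mapsto\theta_s\omega$ is measurable, $\theta_0$ is the identity, and $\theta_s\circ\theta_t=\theta_{s+t}$. $\mathbb{H}$ is a non-empty Polish space with its Borel $\sigma$-field, $|\cdot|\colon\mathbb{H}\to[0,\infty)$ is a measurable map, and $Y\colon\Omega\times\mathbb{G}\to\mathbb{H}$, $Y_s(\omega)=Y(\omega,s)$, is measurable with $Y_s(\theta_t\omega)=Y_{s+t}(\omega)$ for all $\omega,s,t$. The exceedance measure is $\xi:=\int\mathbf 1\{s\in\cdot,\,|Y_s|>1\}\,\lambda(ds)$; write $\xi(\omega,\cdot)$ for its value at $\omega$. $\xi$ is mass-stationary with respect to $\mathbb{Q}$ if for all measurable $g\colon\Omega\times\mathbb{G}\to[0,\infty]$ $$\mathbb{E}_{\mathbb{Q}}\int g(\theta_s,-s)\,\xi(ds)=\mathbb{E}_{\mathbb{Q}}\int g(\theta_0,s)\,\xi(ds).$$ A measurable map $T\colon\Omega\to\mathbb{G}$ is an anchoring map if $T(\theta_s\omega)=T(\omega)-s$ for all $s\in\mathbb{G}$ and all $\omega$ with $0<\xi(\omega,\mathbb{G})<\infty$. $\mathbb{E}_\mu$ denotes integration with respect to $\mu$. *)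

theory Defs
  imports "HOL-Analysis.Analysis" "HOL-Probability.Probability"
begin

text \<open>
  A Haar measure on a second countable locally compact Hausdorff Abelian group.
  No regularity clause is needed: on such a space every Borel measure that is finite on
  compact sets is regular.
\<close>

definition haar_measure ::
  "'g::{topological_ab_group_add, second_countable_topology, t2_space} measure \<Rightarrow> bool" where
  "haar_measure lam \<longleftrightarrow>
     sets lam = sets borel \<and>
     emeasure lam UNIV \<noteq> 0 \<and>
     (\<forall>K. compact K \<longrightarrow> emeasure lam K < \<infinity>) \<and>
     (\<forall>s. \<forall>B\<in>sets borel. emeasure lam ((\<lambda>x. s + x) ` B) = emeasure lam B)"

definition measurable_flow ::
  "'w measure \<Rightarrow>
   ('g::{topological_ab_group_add, second_countable_topology, t2_space} \<Rightarrow> 'w \<Rightarrow> 'w) \<Rightarrow> bool" where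
  "measurable_flow M \<theta> \<longleftrightarrow>
     (\<lambda>(\<omega>, s). \<theta> s \<omega>) \<in> M \<Otimes>\<^sub>M borel \<rightarrow>\<^sub>M M \<and>
     (\<forall>\<omega>\<in>space M. \<theta> 0 \<omega> = \<omega>) \<and>
     (\<forall>s t. \<forall>\<omega>\<in>space M. \<theta> s (\<theta> t \<omega>) = \<theta> (s + t) \<omega>)"

definition flow_covariant_field ::
  "'w measure \<Rightarrow>
   ('g::{topological_ab_group_add, second_countable_topology, t2_space} \<Rightarrow> 'w \<Rightarrow> 'w) \<Rightarrow>
   ('w \<Rightarrow> 'g \<Rightarrow> 'h::polish_space) \<Rightarrow> bool" where
  "flow_covariant_field M \<theta> Y \<longleftrightarrow>
     (\<lambda>(\<omega>, s). Y \<omega> s) \<in> M \<Otimes>\<^sub>M borel \<rightarrow>\<^sub>M borel \<and>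
     (\<forall>s t. \<forall>\<omega>\<in>space M. Y (\<theta> t \<omega>) s = Y \<omega> (s + t))"

text \<open>
  The measure \<open>\<xi>(\<omega>, \<cdot>)\<close>; the argument \<open>nrm\<close> is the map \<open>|\<cdot>|\<close> on the state space,
  which is not assumed to be a norm.
\<close>

definition exceedance_measure ::
  "'g measure \<Rightarrow> ('h \<Rightarrow> real) \<Rightarrow> ('w \<Rightarrow> 'g \<Rightarrow> 'h) \<Rightarrow> 'w \<Rightarrow> 'g measure" where
  "exceedance_measure lam nrm Y \<omega> = density lam (indicator {s. nrm (Y \<omega> s) > 1})"

definition mass_stationary ::
  "'w measure \<Rightarrow>
   ('g::{topological_ab_group_add, second_countable_topology, t2_space} \<Rightarrow> 'w \<Rightarrow> 'w) \<Rightarrow>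
   ('w \<Rightarrow> 'g measure) \<Rightarrow> 'w measure \<Rightarrow> bool" where
  "mass_stationary M \<theta> \<xi> Q \<longleftrightarrow>
     (\<forall>g :: 'w \<times> 'g \<Rightarrow> ennreal. g \<in> borel_measurable (M \<Otimes>\<^sub>M borel) \<longrightarrow>
        (\<integral>\<^sup>+\<omega>. (\<integral>\<^sup>+s. g (\<theta> s \<omega>, - s) \<partial>\<xi> \<omega>) \<partial>Q) =
        (\<integral>\<^sup>+\<omega>. (\<integral>\<^sup>+s. g (\<theta> 0 \<omega>, s) \<partial>\<xi> \<omega>) \<partial>Q))"

definition anchoring_map ::
  "'w measure \<Rightarrow>
   ('g::{topological_ab_group_add, second_countable_topology, t2_space} \<Rightarrow> 'w \<Rightarrow> 'w) \<Rightarrow>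
   ('w \<Rightarrow> 'g measure) \<Rightarrow> ('w \<Rightarrow> 'g) \<Rightarrow> bool" where
  "anchoring_map M \<theta> \<xi> T \<longleftrightarrow>
     T \<in> M \<rightarrow>\<^sub>M borel \<and>
     (\<forall>s. \<forall>\<omega>\<in>space M. 0 < emeasure (\<xi> \<omega>) UNIV \<and> emeasure (\<xi> \<omega>) UNIV < \<infinity> \<longrightarrow>
        T (\<theta> s \<omega>) = T \<omega> - s)"

text \<open>
  The constant \<open>\<vartheta>\<close>, taken in \<open>[0, \<infinity>]\<close>; on the null event where \<open>\<xi>(\<omega>, \<cdot>)\<close> has
  total mass \<open>0\<close> or \<open>\<infinity>\<close> the reciprocal is \<open>\<infinity>\<close> or \<open>0\<close>.
\<close>

definition mean_inverse_mass :: "('w \<Rightarrow> 'g measure) \<Rightarrow> 'w measure \<Rightarrow> ennreal" where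
  "mean_inverse_mass \<xi> Q = (\<integral>\<^sup>+\<omega>. inverse (emeasure (\<xi> \<omega>) UNIV) \<partial>Q)"

definition anchored_measure ::
  "'w measure \<Rightarrow> ('g \<Rightarrow> 'w \<Rightarrow> 'w) \<Rightarrow> ('w \<Rightarrow> 'g measure) \<Rightarrow> 'w measure \<Rightarrow> ('w \<Rightarrow> 'g) \<Rightarrow> 'w measure" where
  "anchored_measure M \<theta> \<xi> Q T =
     scale_measure (inverse (mean_inverse_mass \<xi> Q))
       (distr (density Q (\<lambda>\<omega>. inverse (emeasure (\<xi> \<omega>) UNIV))) M (\<lambda>\<omega>. \<theta> (T \<omega>) \<omega>))"

lemma haar_measure_sigma_finite:
  fixes lam :: "'g::{topological_ab_group_add, second_countable_topology, t2_space} measure"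
  assumes lc: "locally_compact_space (euclidean :: 'g topology)" and lam: "haar_measure lam"
  shows "sigma_finite_measure lam"
proof -
  have sets: "sets lam = sets borel" and fin: "\<And>K. compact K \<Longrightarrow> emeasure lam K < \<infinity>"
    using lam by (auto simp: haar_measure_def)
  have space: "space lam = UNIV"
    using sets_eq_imp_space_eq[OF sets] by simp
  have "\<exists>U K. open U \<and> compact K \<and> x \<in> U \<and> U \<subseteq> K" for x :: 'g
    using lc by (auto simp: locally_compact_space_def)
  then obtain U K where UK: "\<And>x::'g. open (U x) \<and> compact (K x) \<and> x \<in> U x \<and> U x \<subseteq> K x"
    by metis
  obtain F where F: "F \<subseteq> range U" "countable F" "\<Union>F = \<Union>(range U)"
    using Lindelof[of "range U"] UK by blast
  then obtain C where C: "countable C" "F = U ` C"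
    by (metis countable_subset_image)
  show ?thesis
  proof
    show "\<exists>A. countable A \<and> A \<subseteq> sets lam \<and> \<Union>A = space lam \<and> (\<forall>a\<in>A. emeasure lam a \<noteq> \<infinity>)"
    proof (intro exI conjI ballI)
      show "countable (K ` C)" using C by simp
      show "K ` C \<subseteq> sets lam" using UK sets by (auto intro: borel_compact)
      have "\<Union>(U ` C) = UNIV" using F C UK by auto
      moreover have "\<Union>(U ` C) \<subseteq> \<Union>(K ` C)" using UK by blast
      ultimately show "\<Union>(K ` C) = space lam" using space by auto
      show "emeasure lam a \<noteq> \<infinity>" if "a \<in> K ` C" for a
        using that UK fin by (auto simp: less_top)
    qed
  qed
qed

lemma exceedance_measure_total_mass_measurable:
  fixes lam :: "'g::{topological_ab_group_add, second_countable_topology, t2_space} measure"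
    and nrm :: "'h::polish_space \<Rightarrow> real"
  assumes "locally_compact_space (euclidean :: 'g topology)" "haar_measure lam"
    and nrm: "nrm \<in> borel_measurable borel"
    and Y: "(\<lambda>(\<omega>, s). Y \<omega> s) \<in> M \<Otimes>\<^sub>M borel \<rightarrow>\<^sub>M borel"
  shows "(\<lambda>\<omega>. emeasure (exceedance_measure lam nrm Y \<omega>) UNIV) \<in> borel_measurable M"
proof -
  interpret sigma_finite_measure lam by (rule haar_measure_sigma_finite) fact+
  have [measurable_cong]: "sets lam = sets borel" using assms(2) by (simp add: haar_measure_def)
  have sp: "space lam = UNIV" using sets_eq_imp_space_eq[OF \<open>sets lam = sets borel\<close>] by simp
  note nrm[measurable] Y[measurable]
  have *: "(\<lambda>p. indicator {s. nrm (Y (fst p) s) > 1} (snd p) :: ennreal)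
      \<in> borel_measurable (M \<Otimes>\<^sub>M lam)"
    unfolding indicator_def mem_Collect_eq by (measurable; simp)
  have **: "(\<lambda>\<omega>. \<integral>\<^sup>+s. indicator {s. nrm (Y \<omega> s) > 1} s \<partial>lam) \<in> borel_measurable M"
    using borel_measurable_nn_integral_fst[OF *] by simp
  have "emeasure (exceedance_measure lam nrm Y \<omega>) UNIV
      = (\<integral>\<^sup>+s. indicator {s. nrm (Y \<omega> s) > 1} s \<partial>lam)" if "\<omega> \<in> space M" for \<omega>
  proof -
    have "(\<lambda>s. indicator {s. nrm (Y \<omega> s) > 1} s :: ennreal) \<in> borel_measurable lam"
      using measurable_Pair2[OF * that] by simp
    then show ?thesis
      unfolding exceedance_measure_def
      by (subst emeasure_density) (auto simp flip: sp)
  qed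
  with ** show ?thesis by (subst measurable_cong)
qed

lemma prob_space_anchored_measure:
  fixes lam :: "'g::{topological_ab_group_add, second_countable_topology, t2_space} measure"
    and nrm :: "'h::polish_space \<Rightarrow> real" and Y :: "'w \<Rightarrow> 'g \<Rightarrow> 'h"
  defines "\<xi> \<equiv> exceedance_measure lam nrm Y"
  assumes lc: "locally_compact_space (euclidean :: 'g topology)"
    and haar: "haar_measure lam"
    and flow: "measurable_flow M \<theta>"
    and nrm: "nrm \<in> borel_measurable borel"
    and Y: "flow_covariant_field M \<theta> Y"
    and Q: "prob_space Q" and QM: "sets Q = sets M"
    and mass: "measure Q {\<omega> \<in> space M. 0 < emeasure (\<xi> \<omega>) UNIV \<and> emeasure (\<xi> \<omega>) UNIV < \<infinity>} = 1"
    and fin: "mean_inverse_mass \<xi> Q < \<infinity>"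
    and T: "anchoring_map M \<theta> \<xi> T"
  shows "prob_space (anchored_measure M \<theta> \<xi> Q T)"
proof -
  interpret prob_space Q by fact
  note [measurable_cong] = QM
  have spQ: "space Q = space M" using QM by (rule sets_eq_imp_space_eq)
  have [measurable]: "(\<lambda>\<omega>. emeasure (\<xi> \<omega>) UNIV) \<in> borel_measurable M"
    unfolding \<xi>_def using lc haar nrm Y
    by (intro exceedance_measure_total_mass_measurable) (auto simp: flow_covariant_field_def)
  have [measurable]: "T \<in> M \<rightarrow>\<^sub>M borel" "(\<lambda>(\<omega>, s). \<theta> s \<omega>) \<in> M \<Otimes>\<^sub>M borel \<rightarrow>\<^sub>M M"
    using T flow by (auto simp: anchoring_map_def measurable_flow_def)
  have \<theta>T: "(\<lambda>\<omega>. \<theta> (T \<omega>) \<omega>) \<in> M \<rightarrow>\<^sub>M M" by measurable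
  have AE: "AE \<omega> in Q. 0 < emeasure (\<xi> \<omega>) UNIV \<and> emeasure (\<xi> \<omega>) UNIV < \<infinity>"
    using mass by (subst (asm) prob_Collect_eq_1[unfolded spQ]) (auto simp: spQ)
  have "mean_inverse_mass \<xi> Q \<noteq> 0"
  proof
    assume "mean_inverse_mass \<xi> Q = 0"
    then have "AE \<omega> in Q. inverse (emeasure (\<xi> \<omega>) UNIV) = 0"
      unfolding mean_inverse_mass_def by (subst (asm) nn_integral_0_iff_AE) auto
    with AE have "AE \<omega> in Q. False" by eventually_elim (auto simp: ennreal_inverse_eq_0_iff)
    then show False by simp
  qed
  moreover have "emeasure (distr (density Q (\<lambda>\<omega>. inverse (emeasure (\<xi> \<omega>) UNIV))) M
      (\<lambda>\<omega>. \<theta> (T \<omega>) \<omega>)) (space M) = mean_inverse_mass \<xi> Q"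
  proof -
    have "(\<lambda>\<omega>. \<theta> (T \<omega>) \<omega>) -` space M \<inter> space Q = space Q"
      using measurable_space[OF \<theta>T] by (auto simp: spQ)
    then show ?thesis
      using \<theta>T unfolding mean_inverse_mass_def
      by (subst emeasure_distr)
        (auto simp: emeasure_density cong: nn_integral_cong intro!: nn_integral_cong)
  qed
  ultimately show ?thesis
    using fin by (intro prob_spaceI)
      (simp add: anchored_measure_def space_scale_measure ennreal_inverse_mult less_top
        ennreal_divide_self flip: divide_ennreal_def mult.commute)
qed

end

theory Submission
  imports Defs
begin

text \<open>
  Since \<open>\<xi>(\<theta>\<^sub>t \<omega>, \<cdot>) = \<xi>(\<omega>, \<cdot> + t)\<close>, both the total mass \<open>\<xi>(\<omega>, \<bbbG>)\<close> and
  \<open>\<integral> g(\<theta>\<^sub>s \<omega>) \<xi>(\<omega>, ds)\<close> are invariant under the flow. Hence the shift by \<open>T\<close> drops out of the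
  right-hand side, which becomes the integral of \<open>\<xi>(\<omega>, \<bbbG>)\<^sup>-\<^sup>1 \<integral> g(\<theta>\<^sub>s \<omega>) \<xi>(\<omega>, ds)\<close> with respect
  to \<open>Q\<close>. Mass-stationarity, applied to \<open>(\<omega>, s) \<mapsto> \<xi>(\<omega>, \<bbbG>)\<^sup>-\<^sup>1 g(\<omega>)\<close>, turns this into the integral
  of \<open>g\<close>.
\<close>

text \<open>The preimage of a Borel set under \<open>\<lambda>s. s + t\<close> is its translate by
  \<open>- t\<close>, which has the same Haar measure.\<close>

lemma haar_measure_distr_translation:
  fixes lam :: "'g::{topological_ab_group_add, second_countable_topology, t2_space} measure"
  assumes "haar_measure lam"
  shows "distr lam lam (\<lambda>s. s + t) = lam"
proof (rule measure_eqI)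
  have [measurable_cong]: "sets lam = sets borel" using assms by (simp add: haar_measure_def)
  then have sp: "space lam = UNIV" using sets_eq_imp_space_eq[of lam borel] by simp
  have m: "(\<lambda>s. s + t) \<in> lam \<rightarrow>\<^sub>M lam"
    by (simp add: measurable_cong_sets[OF \<open>sets lam = sets borel\<close> \<open>sets lam = sets borel\<close>]
        borel_measurable_continuous_onI continuous_intros)
  fix B assume "B \<in> sets (distr lam lam (\<lambda>s. s + t))"
  then have B: "B \<in> sets lam" by simp
  have "(\<lambda>s. s + t) -` B = (\<lambda>x. - t + x) ` B"
    by (force simp: image_iff algebra_simps intro: bexI[of _ "_ + t"])
  moreover have "emeasure lam ((\<lambda>x. - t + x) ` B) = emeasure lam B"
    using assms B unfolding haar_measure_def by blast
  ultimately show "emeasure (distr lam lam (\<lambda>s. s + t)) B = emeasure lam B"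
    by (simp add: emeasure_distr[OF m B] sp)
qed simp

lemma measurable_field_section:
  assumes "flow_covariant_field M \<theta> Y" and "\<omega> \<in> space M"
  shows "Y \<omega> \<in> borel_measurable borel"
proof -
  have "(\<lambda>(\<omega>, s). Y \<omega> s) \<in> M \<Otimes>\<^sub>M borel \<rightarrow>\<^sub>M borel"
    using assms(1) by (simp add: flow_covariant_field_def)
  from measurable_Pair2[OF this assms(2)] show ?thesis by simp
qed

text \<open>Joint measurability of the flow already contains this: the map sends the point
  \<open>(\<omega>, t)\<close> of the product space into \<open>space M\<close>.\<close>

lemma measurable_flow_space:
  assumes "measurable_flow M \<theta>" and "\<omega> \<in> space M"
  shows "\<theta> t \<omega> \<in> space M"
  using measurable_space[of "\<lambda>(\<omega>, s). \<theta> s \<omega>" "M \<Otimes>\<^sub>M borel" M "(\<omega>, t)"] assms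
  by (simp add: measurable_flow_def space_pair_measure)

lemma nn_integral_exceedance_measure:
  fixes lam :: "'g::{topological_ab_group_add, second_countable_topology, t2_space} measure"
  assumes "haar_measure lam" and nrm[measurable]: "nrm \<in> borel_measurable borel"
    and "flow_covariant_field M \<theta> Y" and "\<omega> \<in> space M"
    and f[measurable]: "f \<in> borel_measurable borel"
  shows "(\<integral>\<^sup>+s. f s \<partial>exceedance_measure lam nrm Y \<omega>) =
    (\<integral>\<^sup>+s. indicator {s. nrm (Y \<omega> s) > 1} s * f s \<partial>lam)"
proof -
  have [measurable_cong]: "sets lam = sets borel" using assms(1) by (simp add: haar_measure_def)
  have [measurable]: "Y \<omega> \<in> borel_measurable borel"
    using assms(3,4) by (rule measurable_field_section)
  show ?thesis
    unfolding exceedance_measure_def by (subst nn_integral_density) (auto simp: indicator_def)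
qed

text \<open>Covariance of \<open>Y\<close> makes the density at \<open>\<theta> t \<omega>\<close>
  the density at \<open>\<omega>\<close> evaluated at \<open>s + t\<close>. The whole integrand is
  then a function of \<open>s + t\<close>, and translation invariance of \<open>lam\<close> removes
  the shift.\<close>

lemma nn_integral_exceedance_measure_flow:
  fixes lam :: "'g::{topological_ab_group_add, second_countable_topology, t2_space} measure"
  assumes haar: "haar_measure lam" and flow: "measurable_flow M \<theta>"
    and nrm[measurable]: "nrm \<in> borel_measurable borel"
    and Y: "flow_covariant_field M \<theta> Y" and \<omega>: "\<omega> \<in> space M"
    and f[measurable]: "f \<in> borel_measurable borel"
  shows "(\<integral>\<^sup>+s. f (s + t) \<partial>exceedance_measure lam nrm Y (\<theta> t \<omega>)) =
    (\<integral>\<^sup>+s. f s \<partial>exceedance_measure lam nrm Y \<omega>)"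
proof -
  have lam_borel[measurable_cong]: "sets lam = sets borel"
    using haar by (simp add: haar_measure_def)
  have [measurable]: "Y \<omega> \<in> borel_measurable borel"
    using Y \<omega> by (rule measurable_field_section)
  have shift_borel: "(\<lambda>s::'g. s + t) \<in> borel_measurable borel"
    by (simp add: borel_measurable_continuous_onI continuous_intros)
  then have shift: "(\<lambda>s. s + t) \<in> lam \<rightarrow>\<^sub>M lam"
    by (simp add: measurable_cong_sets[OF lam_borel lam_borel])
  have "(\<integral>\<^sup>+s. f (s + t) \<partial>exceedance_measure lam nrm Y (\<theta> t \<omega>)) =
      (\<integral>\<^sup>+s. indicator {s. nrm (Y (\<theta> t \<omega>) s) > 1} s * f (s + t) \<partial>lam)"
    using haar nrm Y measurable_flow_space[OF flow \<omega>] measurable_compose[OF shift_borel f]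
    by (rule nn_integral_exceedance_measure)
  also have "\<dots> = (\<integral>\<^sup>+s. indicator {s. nrm (Y \<omega> s) > 1} (s + t) * f (s + t) \<partial>lam)"
    using Y \<omega> by (simp add: flow_covariant_field_def indicator_def)
  also have "\<dots> = (\<integral>\<^sup>+s. indicator {s. nrm (Y \<omega> s) > 1} s * f s \<partial>distr lam lam (\<lambda>s. s + t))"
    using shift by (subst nn_integral_distr) (auto simp: indicator_def)
  also have "\<dots> = (\<integral>\<^sup>+s. f s \<partial>exceedance_measure lam nrm Y \<omega>)"
    using nn_integral_exceedance_measure[OF haar nrm Y \<omega> f]
    by (simp add: haar_measure_distr_translation[OF haar])
  finally show ?thesis .
qed

text \<open>This is the preceding shift formula for the constant function 1.\<close>

lemma emeasure_exceedance_measure_flow: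
  fixes lam :: "'g::{topological_ab_group_add, second_countable_topology, t2_space} measure"
  assumes "haar_measure lam" "measurable_flow M \<theta>" "nrm \<in> borel_measurable borel"
    "flow_covariant_field M \<theta> Y" "\<omega> \<in> space M"
  shows "emeasure (exceedance_measure lam nrm Y (\<theta> t \<omega>)) UNIV =
    emeasure (exceedance_measure lam nrm Y \<omega>) UNIV"
proof -
  have "space (exceedance_measure lam nrm Y \<omega>') = UNIV" for \<omega>'
    using assms(1) sets_eq_imp_space_eq[of lam borel]
    by (simp add: exceedance_measure_def haar_measure_def)
  then show ?thesis
    using nn_integral_exceedance_measure_flow[OF assms, of "\<lambda>_. 1" t]
    by (metis borel_measurable_const mult_1 nn_integral_const)
qed

text \<open>All the measures in question have densities with respect to the one \<sigma>-finite
  measure \<open>lam\<close>, and these densities are jointly measurable, so the measurability part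
  of Tonelli's theorem applies.\<close>

lemma measurable_nn_integral_exceedance_measure:
  fixes lam :: "'g::{topological_ab_group_add, second_countable_topology, t2_space} measure"
  assumes lc: "locally_compact_space (euclidean :: 'g topology)" and haar: "haar_measure lam"
    and nrm[measurable]: "nrm \<in> borel_measurable borel" and Y: "flow_covariant_field M \<theta> Y"
    and f[measurable]: "(\<lambda>(\<omega>, s). f \<omega> s) \<in> borel_measurable (M \<Otimes>\<^sub>M borel)"
  shows "(\<lambda>\<omega>. \<integral>\<^sup>+s. f \<omega> s \<partial>exceedance_measure lam nrm Y \<omega>) \<in> borel_measurable M"
proof -
  interpret sigma_finite_measure lam by (rule haar_measure_sigma_finite) fact+
  have [measurable_cong]: "sets lam = sets borel" using haar by (simp add: haar_measure_def)
  have [measurable]: "(\<lambda>(\<omega>, s). Y \<omega> s) \<in> M \<Otimes>\<^sub>M borel \<rightarrow>\<^sub>M borel"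
    using Y by (simp add: flow_covariant_field_def)
  \<comment> \<open>The set in the indicator varies with \<omega>. Written as a conditional, the
    density is visibly measurable in the pair.\<close>
  have "(\<lambda>p. (if nrm (Y (fst p) (snd p)) > 1 then 1 else 0) * f (fst p) (snd p))
      \<in> borel_measurable (M \<Otimes>\<^sub>M lam)"
    by measurable
  from borel_measurable_nn_integral_fst[OF this]
  have "(\<lambda>\<omega>. \<integral>\<^sup>+s. indicator {s. nrm (Y \<omega> s) > 1} s * f \<omega> s \<partial>lam) \<in> borel_measurable M"
    by (simp add: indicator_def)
  moreover have "f \<omega> \<in> borel_measurable borel" if "\<omega> \<in> space M" for \<omega>
    using measurable_Pair2[OF f that] by simp
  ultimately show ?thesis
    using nn_integral_exceedance_measure[OF haar nrm Y] by (simp cong: measurable_cong)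
qed

theorem proposition8p1:
  fixes M :: "'w measure"
    and lam :: "'g::{topological_ab_group_add, second_countable_topology, t2_space} measure"
    and \<theta> :: "'g \<Rightarrow> 'w \<Rightarrow> 'w"
    and nrm :: "'h::polish_space \<Rightarrow> real"
    and Y :: "'w \<Rightarrow> 'g \<Rightarrow> 'h"
    and Q :: "'w measure"
    and T :: "'w \<Rightarrow> 'g"
  defines "\<xi> \<equiv> exceedance_measure lam nrm Y"
  assumes "locally_compact_space (euclidean :: 'g topology)"
    and "haar_measure lam"
    and "measurable_flow M \<theta>"
    and "nrm \<in> borel_measurable borel" and "\<forall>h. 0 \<le> nrm h"
    and "flow_covariant_field M \<theta> Y"
    and "prob_space Q" and "sets Q = sets M"
    and "mass_stationary M \<theta> \<xi> Q"
    and "measure Q {\<omega> \<in> space M. 0 < emeasure (\<xi> \<omega>) UNIV \<and> emeasure (\<xi> \<omega>) UNIV < \<infinity>} = 1"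
    and "mean_inverse_mass \<xi> Q < \<infinity>"
    and "anchoring_map M \<theta> \<xi> T"
  shows "\<forall>g :: 'w \<Rightarrow> ennreal. g \<in> borel_measurable M \<longrightarrow>
    (\<integral>\<^sup>+\<omega>. g \<omega> \<partial>Q) =
      mean_inverse_mass \<xi> Q *
      (\<integral>\<^sup>+\<omega>. (\<integral>\<^sup>+s. g (\<theta> s \<omega>) \<partial>\<xi> \<omega>) \<partial>anchored_measure M \<theta> \<xi> Q T)"
proof (intro allI impI)
  fix g :: "'w \<Rightarrow> ennreal" assume g[measurable]: "g \<in> borel_measurable M"
  note lc = assms(2) and haar = assms(3) and flow = assms(4) and nrm = assms(5) and Y = assms(7)
    and QM[measurable_cong] = assms(9) and stat = assms(10) and mass = assms(11)
    and fin = assms(12)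
  interpret prob_space Q by (rule assms)
  have spQ: "space Q = space M" using QM by (rule sets_eq_imp_space_eq)
  \<comment> \<open>\<open>m\<close> and \<open>G\<close> are the two functions of \<omega> to be
    shown invariant under the flow.\<close>
  define m where "m \<omega> = emeasure (\<xi> \<omega>) UNIV" for \<omega>
  define G where "G \<omega> = (\<integral>\<^sup>+s. g (\<theta> s \<omega>) \<partial>\<xi> \<omega>)" for \<omega>
  let ?c = "mean_inverse_mass \<xi> Q"
  have [measurable]: "m \<in> borel_measurable M"
    unfolding m_def \<xi>_def using lc haar nrm Y
    by (intro exceedance_measure_total_mass_measurable) (auto simp: flow_covariant_field_def)
  have [measurable]: "T \<in> M \<rightarrow>\<^sub>M borel"
    and \<theta>_measurable[measurable]: "(\<lambda>(\<omega>, s). \<theta> s \<omega>) \<in> M \<Otimes>\<^sub>M borel \<rightarrow>\<^sub>M M"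
    using assms(13) flow by (auto simp: anchoring_map_def measurable_flow_def)
  have [measurable]: "(\<lambda>\<omega>. \<theta> (T \<omega>) \<omega>) \<in> M \<rightarrow>\<^sub>M M" by measurable
  have \<theta>_section: "(\<lambda>s. \<theta> s \<omega>) \<in> borel \<rightarrow>\<^sub>M M" if "\<omega> \<in> space M" for \<omega>
    using measurable_Pair2[OF \<theta>_measurable that] by simp
  have [measurable]: "G \<in> borel_measurable M"
    unfolding G_def \<xi>_def using lc haar nrm Y
    by (rule measurable_nn_integral_exceedance_measure) measurable
  have sets_\<xi>[measurable_cong]: "sets (\<xi> \<omega>) = sets borel" for \<omega>
    using haar by (simp add: \<xi>_def exceedance_measure_def haar_measure_def)
  have sp_\<xi>: "space (\<xi> \<omega>) = UNIV" for \<omega>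
    using sets_eq_imp_space_eq[OF sets_\<xi>] by simp
  have m_flow: "m (\<theta> t \<omega>) = m \<omega>" if "\<omega> \<in> space M" for t \<omega>
    unfolding m_def \<xi>_def using haar flow nrm Y that by (rule emeasure_exceedance_measure_flow)
  have G_flow: "G (\<theta> t \<omega>) = G \<omega>" if \<omega>: "\<omega> \<in> space M" for t \<omega>
  proof -
    \<comment> \<open>The flow property turns the integrand into \<open>f (s + t)\<close> with
      \<open>f s = g (\<theta> s \<omega>)\<close>, the form required by the shift formula.\<close>
    have "G (\<theta> t \<omega>) = (\<integral>\<^sup>+s. g (\<theta> (s + t) \<omega>) \<partial>\<xi> (\<theta> t \<omega>))"
      using flow \<omega> by (simp add: G_def measurable_flow_def)
    also have "\<dots> = G \<omega>"
      unfolding G_def \<xi>_def using haar flow nrm Y \<omega> measurable_compose[OF \<theta>_section[OF \<omega>] g]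
      by (rule nn_integral_exceedance_measure_flow)
    finally show ?thesis .
  qed
  have AE: "AE \<omega> in Q. 0 < m \<omega> \<and> m \<omega> < \<infinity>"
    using mass unfolding m_def[symmetric]
    by (subst (asm) prob_Collect_eq_1[unfolded spQ]) (auto simp: spQ)
  \<comment> \<open>If the mean vanished, \<open>inverse (m \<omega>)\<close> would be 0 almost
    everywhere, forcing infinite mass there.\<close>
  have c0: "?c \<noteq> 0"
  proof
    assume "?c = 0"
    then have "AE \<omega> in Q. inverse (m \<omega>) = 0"
      unfolding mean_inverse_mass_def m_def[symmetric] by (subst (asm) nn_integral_0_iff_AE) auto
    with AE have "AE \<omega> in Q. False" by eventually_elim (auto simp: ennreal_inverse_eq_0_iff)
    then show False by simp
  qed
  have "?c * (\<integral>\<^sup>+\<omega>. G \<omega> \<partial>anchored_measure M \<theta> \<xi> Q T) =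
      ?c * (inverse ?c * (\<integral>\<^sup>+\<omega>. inverse (m \<omega>) * G (\<theta> (T \<omega>) \<omega>) \<partial>Q))"
    unfolding anchored_measure_def m_def[symmetric]
    by (simp add: nn_integral_scale_measure nn_integral_distr nn_integral_density)
  \<comment> \<open>Cancelling the normalising constant in \<open>ennreal\<close> requires it to be
    neither 0 nor \<infinity>.\<close>
  also have "\<dots> = (\<integral>\<^sup>+\<omega>. inverse (m \<omega>) * G (\<theta> (T \<omega>) \<omega>) \<partial>Q)"
    using c0 fin by (simp add: mult.assoc[symmetric] ennreal_divide_self flip: divide_ennreal_def)
  \<comment> \<open>Invariance of \<open>G\<close> erases the shift by \<open>T \<omega>\<close>.
    Invariance of \<open>m\<close> is used in the opposite direction: \<open>m \<omega>\<close>
    becomes \<open>m (\<theta> s \<omega>)\<close>, so that the integrand depends on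
    \<open>\<theta> s \<omega>\<close> alone, as on the left-hand side of mass-stationarity.\<close>
  also have "\<dots> = (\<integral>\<^sup>+\<omega>. (\<integral>\<^sup>+s. inverse (m (\<theta> s \<omega>)) * g (\<theta> s \<omega>) \<partial>\<xi> \<omega>) \<partial>Q)"
  proof (rule nn_integral_cong)
    fix \<omega> assume "\<omega> \<in> space Q"
    then have \<omega>: "\<omega> \<in> space M" by (simp add: spQ)
    have "(\<lambda>s. g (\<theta> s \<omega>)) \<in> borel_measurable (\<xi> \<omega>)"
      using measurable_compose[OF \<theta>_section[OF \<omega>] g] by measurable
    then show "inverse (m \<omega>) * G (\<theta> (T \<omega>) \<omega>) =
        (\<integral>\<^sup>+s. inverse (m (\<theta> s \<omega>)) * g (\<theta> s \<omega>) \<partial>\<xi> \<omega>)"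
      using \<omega> by (simp add: G_flow m_flow nn_integral_cmult) (simp add: G_def)
  qed
  also have "\<dots> = (\<integral>\<^sup>+\<omega>. (\<integral>\<^sup>+s. inverse (m (\<theta> 0 \<omega>)) * g (\<theta> 0 \<omega>) \<partial>\<xi> \<omega>) \<partial>Q)"
    using stat[unfolded mass_stationary_def, rule_format, of "\<lambda>p. inverse (m (fst p)) * g (fst p)"]
    by simp
  \<comment> \<open>Since \<open>\<theta> 0\<close> is the identity and the inner integrand is
    constant in \<open>s\<close>, integrating it only contributes the factor
    \<open>m \<omega>\<close>.\<close>
  also have "\<dots> = (\<integral>\<^sup>+\<omega>. inverse (m \<omega>) * g \<omega> * m \<omega> \<partial>Q)"
    using flow by (intro nn_integral_cong) (simp add: sp_\<xi> m_def spQ measurable_flow_def)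
  \<comment> \<open>In \<open>ennreal\<close> the product of \<open>m \<omega>\<close> and its
    inverse is 1 when the mass is positive and finite, hence almost everywhere under
    \<open>Q\<close>.\<close>
  also have "\<dots> = (\<integral>\<^sup>+\<omega>. g \<omega> \<partial>Q)"
    using AE
    by (intro nn_integral_cong_AE, eventually_elim)
      (metis divide_ennreal_def ennreal_divide_self infinity_ennreal_def mult.assoc mult.commute
        mult_1 order_less_irrefl)
  finally show "(\<integral>\<^sup>+\<omega>. g \<omega> \<partial>Q) =
      ?c * (\<integral>\<^sup>+\<omega>. (\<integral>\<^sup>+s. g (\<theta> s \<omega>) \<partial>\<xi> \<omega>) \<partial>anchored_measure M \<theta> \<xi> Q T)"
    by (simp add: G_def)
qed

end
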